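(* Let $\mathfrak g$ be a nonzero complete left-symmetric algebra over $\mathbb C$ whose canonical decomposition $\mathfrak g=\bigoplus_\lambda\mathfrak g^\lambda$ satisfies $\dim\mathfrak g^\lambda\le 1$ for all $\lambda$. Then each pair of consecutive edges in $\Gamma_l$ can be included either in a triangle or in a (possibly degenerate) parallelogram in $\Gamma_l$; that is, if $\Gamma_l$ contains an edge from $\lambda$ to $\mu$ and an edge from $\mu$ to $\nu$, then $\Gamma_l$ contains the edge from $\lambda$ to $\nu$, or $\lambda+\nu-\mu$ is a vertex of $\Gamma_l$ and $\Gamma_l$ contains both the edge from $\lambda$ to $\lambda+\nu-\mu$ and the edge from $\lambda+\nu-\mu$ to $\nu$.
   Context: All algebras are finite dimensional. A left-symmetric algebra is a vector space $\mathfrak g$ with a bilinear product such that $x(yz)-(xy)z=y(xz)-(yx)z$ for all $x,y,z$. Then $[x,y]=xy-yx$ is a Lie bracket and $L(x)y=xy$ defines a representation of the Lie algebra $\mathfrak g$. The fields $F_x(y)=xy+x$, $x\in\mathfrak g$, form a Lie algebra of affine vector fields on the space $\mathfrak g$; $\mathfrak g$ is complete if the group of affine transformations generated by their flows acts transitively on $\mathfrak g$. Canonical decomposition: a complete left-symmetric algebra over $\mathbb C$ has a unique Cartan subalgebra $\mathfrak h$ of the Lie algebra $\mathfrak g$ such that, for every linear functional $\lambda$ on $\mathfrak h$, the root subspace (generalized weight space) $\mathfrak g^\lambda$ of $\lambda$ for $L|_{\mathfrak h}$ equals the root subspace for $\operatorname{ad}|_{\mathfrak h}$; the canonical decomposition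 is $\mathfrak g=\bigoplus_\lambda\mathfrak g^\lambda$, and $\mathfrak g^0=\mathfrak h$. It satisfies $\mathfrak g^\lambda\mathfrak g^\mu\subseteq\mathfrak g^{\lambda+\mu}$. Graphs: assume $\dim\mathfrak g^\lambda\le1$ for all $\lambda$. Fix $e_0\in\mathfrak g^0$, $e_0\neq0$. Identify each functional $\lambda$ with $\mathfrak g^\lambda\ne0$ with the number $\lambda(e_0)$; the set of these numbers is $\Lambda\subset\mathbb C$, the spectrum of $L(e_0)$ (it contains $0$). For each $\lambda\in\Lambda$ choose an eigenvector $e_\lambda\in\mathfrak g^\lambda$, $e_0e_\lambda=\lambda e_\lambda$ (with the chosen $e_0$ for $\lambda=0$). In the base $\{e_\lambda\}_{\lambda\in\Lambda}$ the product is $e_\lambda e_\mu=c_{\lambda,\mu}e_{\lambda+\mu}$, with the convention $e_\lambda=0$ and $c_{\lambda,\mu}=c_{\mu,\lambda}=0$ if $\lambda\notin\Lambda$. $\Gamma_l$ is the directed graph (loops allowed) with vertex set $\Lambda$ having an edge from $\lambda$ to $\mu$ if and only if $c_{\mu-\lambda,\lambda}\neq0$. *)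

theory Defs
  imports Complex_Main
begin

locale left_symmetric_algebra = vector_space scale
  for scale :: "complex \<Rightarrow> 'a::ab_group_add \<Rightarrow> 'a"  (infixr "*s" 75) +
  fixes mult :: "'a \<Rightarrow> 'a \<Rightarrow> 'a"  (infixl "\<star>" 70)
  assumes finite_dim: "\<exists>Basis. finite_dimensional_vector_space scale Basis"
    and linear_mult_right: "Vector_Spaces.linear scale scale (\<lambda>y. x \<star> y)"
    and linear_mult_left: "Vector_Spaces.linear scale scale (\<lambda>x. x \<star> y)"
    and left_symmetric: "x \<star> (y \<star> z) - (x \<star> y) \<star> z = y \<star> (x \<star> z) - (y \<star> x) \<star> z"
begin

definition lie_bracket :: "'a \<Rightarrow> 'a \<Rightarrow> 'a" where
  "lie_bracket x y = x \<star> y - y \<star> x"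

definition affine_field :: "'a \<Rightarrow> 'a \<Rightarrow> 'a" where
  "affine_field x y = x \<star> y + x"

text \<open>The algebra carries no topology of its own; the derivative of a curve in a
  finite-dimensional space is expressed by testing against all linear functionals.\<close>

definition integral_curve :: "'a \<Rightarrow> (real \<Rightarrow> 'a) \<Rightarrow> bool" where
  "integral_curve x \<gamma> \<longleftrightarrow>
     (\<forall>\<phi>. Vector_Spaces.linear scale (*) \<phi> \<longrightarrow>
       (\<forall>t. ((\<lambda>s. \<phi> (\<gamma> s)) has_vector_derivative \<phi> (affine_field x (\<gamma> t))) (at t)))"

text \<open>Real times suffice: the flow of \<open>affine_field x\<close> at time \<open>\<i> t\<close> is the flow of
  \<open>affine_field (\<i> *s x)\<close> at time \<open>t\<close>.\<close>

definition is_flow_map :: "'a \<Rightarrow> real \<Rightarrow> ('a \<Rightarrow> 'a) \<Rightarrow> bool" where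
  "is_flow_map x t \<Phi> \<longleftrightarrow> (\<forall>y. \<exists>\<gamma>. integral_curve x \<gamma> \<and> \<gamma> 0 = y \<and> \<gamma> t = \<Phi> y)"

inductive_set flow_group :: "('a \<Rightarrow> 'a) set" where
  flow: "is_flow_map x t \<Phi> \<Longrightarrow> \<Phi> \<in> flow_group"
| id: "id \<in> flow_group"
| comp: "\<Phi> \<in> flow_group \<Longrightarrow> \<Psi> \<in> flow_group \<Longrightarrow> \<Phi> \<circ> \<Psi> \<in> flow_group"
| inv: "\<Phi> \<in> flow_group \<Longrightarrow> inv \<Phi> \<in> flow_group"

definition complete_lsa :: bool where
  "complete_lsa \<longleftrightarrow> (\<forall>y z. \<exists>\<Phi>\<in>flow_group. \<Phi> y = z)"

definition lie_subalgebra :: "'a set \<Rightarrow> bool" where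
  "lie_subalgebra \<hh> \<longleftrightarrow> subspace \<hh> \<and> (\<forall>x\<in>\<hh>. \<forall>y\<in>\<hh>. lie_bracket x y \<in> \<hh>)"

primrec lower_central :: "'a set \<Rightarrow> nat \<Rightarrow> 'a set" where
  "lower_central \<hh> 0 = \<hh>"
| "lower_central \<hh> (Suc n) = span {lie_bracket x y | x y. x \<in> \<hh> \<and> y \<in> lower_central \<hh> n}"

definition cartan_subalgebra :: "'a set \<Rightarrow> bool" where
  "cartan_subalgebra \<hh> \<longleftrightarrow> lie_subalgebra \<hh> \<and> (\<exists>n. lower_central \<hh> n = {0}) \<and>
     {x. \<forall>y\<in>\<hh>. lie_bracket x y \<in> \<hh>} = \<hh>"

text \<open>A functional on \<open>\<hh>\<close> is represented by any function on the whole space that is linear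
  on \<open>\<hh>\<close>; only its values on \<open>\<hh>\<close> are used below.\<close>

definition functional_on :: "'a set \<Rightarrow> ('a \<Rightarrow> complex) \<Rightarrow> bool" where
  "functional_on \<hh> \<alpha> \<longleftrightarrow> (\<forall>x\<in>\<hh>. \<forall>y\<in>\<hh>. \<alpha> (x + y) = \<alpha> x + \<alpha> y) \<and>
     (\<forall>c. \<forall>x\<in>\<hh>. \<alpha> (c *s x) = c * \<alpha> x)"

definition weight_space :: "('a \<Rightarrow> 'a \<Rightarrow> 'a) \<Rightarrow> 'a set \<Rightarrow> ('a \<Rightarrow> complex) \<Rightarrow> 'a set" where
  "weight_space \<rho> \<hh> \<alpha> = {y. \<forall>x\<in>\<hh>. \<exists>n. ((\<lambda>z. \<rho> x z - \<alpha> x *s z) ^^ n) y = 0}"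

abbreviation root_space :: "'a set \<Rightarrow> ('a \<Rightarrow> complex) \<Rightarrow> 'a set" where
  "root_space \<equiv> weight_space (\<star>)"

definition canonical_cartan :: "'a set \<Rightarrow> bool" where
  "canonical_cartan \<hh> \<longleftrightarrow> cartan_subalgebra \<hh> \<and>
     (\<forall>\<alpha>. functional_on \<hh> \<alpha> \<longrightarrow> root_space \<hh> \<alpha> = weight_space lie_bracket \<hh> \<alpha>)"

definition root_dims_le_1 :: "'a set \<Rightarrow> bool" where
  "root_dims_le_1 \<hh> \<longleftrightarrow> (\<forall>\<alpha>. functional_on \<hh> \<alpha> \<longrightarrow> dim (root_space \<hh> \<alpha>) \<le> 1)"

definition roots :: "'a set \<Rightarrow> ('a \<Rightarrow> complex) set" where
  "roots \<hh> = {\<alpha>. functional_on \<hh> \<alpha> \<and> root_space \<hh> \<alpha> \<noteq> {0}}"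

definition root_numbers :: "'a set \<Rightarrow> 'a \<Rightarrow> complex set" where
  "root_numbers \<hh> e0 = (\<lambda>\<alpha>. \<alpha> e0) ` roots \<hh>"

text \<open>The chosen vector \<open>e\<^sub>0\<close> is \<open>e 0\<close>.  When the root spaces are at most one-dimensional,
  \<open>\<hh>\<close> is spanned by it, so a root is determined on \<open>\<hh>\<close> by its value at \<open>e 0\<close>.\<close>

definition root_base :: "'a set \<Rightarrow> (complex \<Rightarrow> 'a) \<Rightarrow> bool" where
  "root_base \<hh> e \<longleftrightarrow> e 0 \<in> root_space \<hh> (\<lambda>_. 0) \<and> e 0 \<noteq> 0 \<and>
     (\<forall>\<alpha>\<in>roots \<hh>. e (\<alpha> (e 0)) \<in> root_space \<hh> \<alpha> \<and> e (\<alpha> (e 0)) \<noteq> 0 \<and>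
        e 0 \<star> e (\<alpha> (e 0)) = \<alpha> (e 0) *s e (\<alpha> (e 0))) \<and>
     (\<forall>z. z \<notin> root_numbers \<hh> (e 0) \<longrightarrow> e z = 0)"

text \<open>If \<open>\<kappa> + \<mu>\<close> is not a vertex, the equation for the structure constant does not
  determine it; it is set to 0, and such constants do not occur in the graph.\<close>

definition structure_const :: "'a set \<Rightarrow> (complex \<Rightarrow> 'a) \<Rightarrow> complex \<Rightarrow> complex \<Rightarrow> complex" where
  "structure_const \<hh> e \<kappa> \<mu> =
     (if {\<kappa>, \<mu>, \<kappa> + \<mu>} \<subseteq> root_numbers \<hh> (e 0)
      then (THE c. e \<kappa> \<star> e \<mu> = c *s e (\<kappa> + \<mu>)) else 0)"

definition graph_l_verts :: "'a set \<Rightarrow> (complex \<Rightarrow> 'a) \<Rightarrow> complex set" where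
  "graph_l_verts \<hh> e = root_numbers \<hh> (e 0)"

definition graph_l_edges :: "'a set \<Rightarrow> (complex \<Rightarrow> 'a) \<Rightarrow> (complex \<times> complex) set" where
  "graph_l_edges \<hh> e = {(\<kappa>, \<mu>). \<kappa> \<in> graph_l_verts \<hh> e \<and> \<mu> \<in> graph_l_verts \<hh> e \<and>
     structure_const \<hh> e (\<mu> - \<kappa>) \<kappa> \<noteq> 0}"

end

end

theory Submission
  imports Defs
begin

text \<open>
  Write \<open>L x y = x \<star> y\<close>.  Left symmetry says that \<open>L\<close> is a representation of the Lie
  algebra: \<open>L x (L y z) = L [x, y] z + L y (L x z)\<close> (\<open>mult_mult_eq\<close>).  For consecutive edges
  \<open>\<kappa> \<rightarrow> \<mu> \<rightarrow> \<nu>\<close> put \<open>a = \<mu> - \<kappa>\<close> and \<open>b = \<nu> - \<mu>\<close>, and apply this identity to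
  \<open>e b\<close>, \<open>e a\<close>, \<open>e \<kappa>\<close>.  The left-hand side is a nonzero multiple of \<open>e \<nu>\<close>, since it
  follows the two given edges.  So one of the terms on the right is nonzero.  The first is a
  multiple of \<open>e (a + b) \<star> e \<kappa>\<close>, which is the edge \<open>\<kappa> \<rightarrow> \<nu>\<close>; the second,
  \<open>e a \<star> (e b \<star> e \<kappa>)\<close>, traverses the other two sides of the parallelogram.

  This needs that \<open>e \<kappa> \<star> e \<mu>\<close> is always a multiple of \<open>e (\<kappa> + \<mu>)\<close>
  (\<open>base_mult_base\<close>).  The operator \<open>L (e 0)\<close> is not a derivation; instead
  \<open>L (e 0) (x \<star> y) = [e 0, x] \<star> y + x \<star> L (e 0) y\<close>, so weights add up when \<open>x\<close> is a
  weight vector for \<open>ad\<close> and \<open>y\<close> one for \<open>L\<close>.  The coincidence of the two families of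
  root spaces provides exactly that: \<open>e \<kappa>\<close> is an eigenvector of both \<open>L (e 0)\<close> and
  \<open>ad (e 0)\<close> (\<open>base_eigen_bracket\<close>), because a nilpotent operator on a line is zero.  To get
  back from eigenvectors of \<open>L (e 0)\<close> to root spaces, one uses that the Cartan subalgebra,
  being nilpotent, lies in its own zero root space, and hence is the line through \<open>e 0\<close>
  (\<open>cartan_eq_span\<close>).
\<close>

context left_symmetric_algebra
begin

section \<open>Bilinearity and left symmetry\<close>

lemma mult_simps:
  "x \<star> 0 = 0" "0 \<star> x = 0"
  "x \<star> (c *s y) = c *s (x \<star> y)" "(c *s x) \<star> y = c *s (x \<star> y)"
  "(x - z) \<star> y = x \<star> y - z \<star> y" "x \<star> (y - z) = x \<star> y - x \<star> z"
proof -
  interpret R: Vector_Spaces.linear scale scale "\<lambda>y. w \<star> y" for w by (rule linear_mult_right)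
  interpret L: Vector_Spaces.linear scale scale "\<lambda>w. w \<star> y" for y by (rule linear_mult_left)
  show "x \<star> 0 = 0" "0 \<star> x = 0"
    "x \<star> (c *s y) = c *s (x \<star> y)" "(c *s x) \<star> y = c *s (x \<star> y)"
    "(x - z) \<star> y = x \<star> y - z \<star> y" "x \<star> (y - z) = x \<star> y - x \<star> z"
    by (rule R.zero L.zero R.scale L.scale L.diff R.diff)+
qed

lemma mult_mult_eq: "x \<star> (y \<star> z) = lie_bracket x y \<star> z + y \<star> (x \<star> z)"
  using left_symmetric[of x y z] by (simp add: lie_bracket_def mult_simps algebra_simps)

lemma lie_bracket_scale_left: "lie_bracket (c *s x) y = c *s lie_bracket x y"
  by (simp add: lie_bracket_def mult_simps scale_right_diff_distrib)

lemma lie_bracket_scale_right: "lie_bracket x (c *s y) = c *s lie_bracket x y"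
  by (simp add: lie_bracket_def mult_simps scale_right_diff_distrib)

lemma scaled_if_dim_le_1:
  assumes "dim V \<le> 1" "u \<in> V" "v \<in> V" "u \<noteq> 0"
  obtains c where "v = c *s u"
proof -
  obtain Basis where "finite_dimensional_vector_space scale Basis"
    using finite_dim by blast
  then interpret fd: finite_dimensional_vector_space scale Basis .
  have "v \<in> span {u}"
  proof (rule ccontr)
    assume v: "v \<notin> span {u}"
    then have "independent {v, u}"
      using \<open>u \<noteq> 0\<close> by (simp add: independent_insert)
    then have "card {v, u} \<le> dim V"
      using assms by (intro fd.independent_card_le_dim) auto
    moreover have "v \<noteq> u"
      using v by (auto intro: span_base)
    ultimately show False
      using assms(1) by simp
  qed
  then show thesis
    using that by (auto simp: span_singleton)
qed

section \<open>The Cartan subalgebra and the root base\<close>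

text \<open>Elements of a nilpotent Lie algebra act nilpotently on it.\<close>

lemma cartan_subset_weight_space_0:
  assumes "cartan_subalgebra \<hh>"
  shows "\<hh> \<subseteq> weight_space lie_bracket \<hh> (\<lambda>_. 0)"
proof
  fix y assume y: "y \<in> \<hh>"
  obtain n where n: "lower_central \<hh> n = {0}"
    using assms by (auto simp: cartan_subalgebra_def)
  have "((\<lambda>z. lie_bracket x z - 0 *s z) ^^ k) y \<in> lower_central \<hh> k" if "x \<in> \<hh>" for x k
  proof (induction k)
    case 0
    then show ?case using y by simp
  next
    case (Suc k)
    then show ?case using that by (auto intro!: span_base)
  qed
  from this[where k = n] show "y \<in> weight_space lie_bracket \<hh> (\<lambda>_. 0)"
    using n by (auto simp: weight_space_def)
qed

lemma functional_on_zero: "functional_on \<hh> (\<lambda>_. 0)"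
  by (simp add: functional_on_def)

lemma functional_on_add:
  "functional_on \<hh> \<alpha> \<Longrightarrow> functional_on \<hh> \<beta> \<Longrightarrow> functional_on \<hh> (\<lambda>x. \<alpha> x + \<beta> x)"
  by (simp add: functional_on_def algebra_simps)

lemma cartan_eq_span:
  assumes can: "canonical_cartan \<hh>" and dims: "root_dims_le_1 \<hh>" and base: "root_base \<hh> e"
  shows "\<hh> = span {e 0}"
proof
  have cartan: "cartan_subalgebra \<hh>"
    using can by (simp add: canonical_cartan_def)
  have e0: "e 0 \<in> root_space \<hh> (\<lambda>_. 0)" "e 0 \<noteq> 0"
    using base by (auto simp: root_base_def)
  have "\<hh> \<subseteq> root_space \<hh> (\<lambda>_. 0)"
    using cartan_subset_weight_space_0[OF cartan] can functional_on_zero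
    by (auto simp: canonical_cartan_def)
  moreover have "dim (root_space \<hh> (\<lambda>_. 0)) \<le> 1"
    using dims functional_on_zero unfolding root_dims_le_1_def by blast
  ultimately have "\<exists>c. x = c *s e 0" if "x \<in> \<hh>" for x
    using that e0 by (blast elim: scaled_if_dim_le_1)
  then show sub: "\<hh> \<subseteq> span {e 0}"
    by (auto simp: span_singleton)
  have sp: "subspace \<hh>"
    using cartan by (simp add: cartan_subalgebra_def lie_subalgebra_def)
  \<comment> \<open>The zero subalgebra is not self-normalizing in a nonzero algebra.\<close>
  have "\<hh> \<noteq> {0}"
  proof
    assume "\<hh> = {0}"
    moreover have "{x. \<forall>y\<in>\<hh>. lie_bracket x y \<in> \<hh>} = \<hh>"
      using cartan by (simp add: cartan_subalgebra_def)
    ultimately have "e 0 \<in> {0}"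
      by (auto simp: lie_bracket_def mult_simps)
    then show False using e0(2) by simp
  qed
  then obtain x where "x \<in> \<hh>" "x \<noteq> 0"
    using subspace_0[OF sp] by blast
  moreover from this sub obtain c where "x = c *s e 0"
    by (auto simp: span_singleton)
  ultimately have "e 0 \<in> \<hh>"
    using subspace_scale[OF sp, of x "inverse c"] by auto
  then show "span {e 0} \<subseteq> \<hh>"
    using sp by (intro span_minimal) auto
qed

text \<open>An operator with a generalized eigenvector has, at the last nonzero iterate, a true
  eigenvector; if the weight space is a line, that iterate is a multiple of the given vector.\<close>

lemma base_eigen_bracket:
  assumes can: "canonical_cartan \<hh>" and dims: "root_dims_le_1 \<hh>" and base: "root_base \<hh> e"
    and \<alpha>: "\<alpha> \<in> roots \<hh>"
  shows "lie_bracket (e 0) (e (\<alpha> (e 0))) = \<alpha> (e 0) *s e (\<alpha> (e 0))"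
proof -
  define v where "v = e (\<alpha> (e 0))"
  define T where "T = (\<lambda>z. lie_bracket (e 0) z - \<alpha> (e 0) *s z)"
  have fn: "functional_on \<hh> \<alpha>" using \<alpha> by (simp add: roots_def)
  have \<hh>: "\<hh> = span {e 0}" by (rule cartan_eq_span[OF can dims base])
  then have e0: "e 0 \<in> \<hh>" by (auto intro: span_base)
  have v: "v \<in> weight_space lie_bracket \<hh> \<alpha>" "v \<noteq> 0"
    using base can fn \<alpha> by (auto simp: v_def root_base_def canonical_cartan_def)
  have nil: "\<exists>n. (T ^^ n) v = 0"
    using v(1) e0 by (auto simp: weight_space_def T_def)
  define n where "n = (LEAST n. (T ^^ n) v = 0)"
  have n: "(T ^^ n) v = 0" unfolding n_def by (rule LeastI_ex[OF nil])
  then have "n \<noteq> 0" using v(2) by (cases n) auto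
  then obtain m where m: "n = Suc m" using not0_implies_Suc by blast
  define w where "w = (T ^^ m) v"
  have "w \<noteq> 0" using not_less_Least[of m "\<lambda>n. (T ^^ n) v = 0"] m by (auto simp: w_def n_def)
  have "T w = 0" using n m by (simp add: w_def)
  have "w \<in> weight_space lie_bracket \<hh> \<alpha>"
    unfolding weight_space_def
  proof safe
    fix x assume "x \<in> \<hh>"
    then obtain c where c: "x = c *s e 0" using \<hh> by (auto simp: span_singleton)
    then have "\<alpha> x = c * \<alpha> (e 0)" using fn e0 by (auto simp: functional_on_def)
    then have "lie_bracket x w - \<alpha> x *s w = c *s T w"
      by (simp add: c T_def lie_bracket_scale_left scale_right_diff_distrib)
    then have "((\<lambda>z. lie_bracket x z - \<alpha> x *s z) ^^ 1) w = 0"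
      using \<open>T w = 0\<close> by simp
    then show "\<exists>n. ((\<lambda>z. lie_bracket x z - \<alpha> x *s z) ^^ n) w = 0" by blast
  qed
  moreover have "dim (weight_space lie_bracket \<hh> \<alpha>) \<le> 1"
    using can dims fn by (auto simp: root_dims_le_1_def canonical_cartan_def)
  ultimately obtain c where "v = c *s w"
    using v \<open>w \<noteq> 0\<close> by (blast elim: scaled_if_dim_le_1)
  then have "lie_bracket (e 0) v = \<alpha> (e 0) *s v"
    using \<open>T w = 0\<close> by (simp add: T_def lie_bracket_scale_right mult.commute)
  then show ?thesis by (simp add: v_def)
qed

lemma base_eq_0_iff:
  assumes "root_base \<hh> e"
  shows "e z = 0 \<longleftrightarrow> z \<notin> root_numbers \<hh> (e 0)"
  using assms unfolding root_base_def root_numbers_def by blast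

lemma base_mult_base:
  assumes can: "canonical_cartan \<hh>" and dims: "root_dims_le_1 \<hh>" and base: "root_base \<hh> e"
  obtains c where "e \<kappa> \<star> e \<mu> = c *s e (\<kappa> + \<mu>)"
proof (cases "e \<kappa> \<star> e \<mu> = 0")
  case True
  then show thesis using that[of 0] by simp
next
  case False
  define w where "w = e \<kappa> \<star> e \<mu>"
  have "e \<kappa> \<noteq> 0" "e \<mu> \<noteq> 0" using False by (auto simp: mult_simps)
  then obtain \<alpha> \<beta> where \<alpha>: "\<alpha> \<in> roots \<hh>" "\<kappa> = \<alpha> (e 0)" and \<beta>: "\<beta> \<in> roots \<hh>" "\<mu> = \<beta> (e 0)"
    using base_eq_0_iff[OF base] by (auto simp: root_numbers_def)
  have \<hh>: "\<hh> = span {e 0}" by (rule cartan_eq_span[OF can dims base])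
  then have e0: "e 0 \<in> \<hh>" by (auto intro: span_base)
  define \<gamma> where "\<gamma> = (\<lambda>x. \<alpha> x + \<beta> x)"
  have fn: "functional_on \<hh> \<gamma>"
    using \<alpha> \<beta> functional_on_add by (simp add: \<gamma>_def roots_def)
  have "lie_bracket (e 0) (e \<kappa>) = \<kappa> *s e \<kappa>"
    using base_eigen_bracket[OF can dims base \<alpha>(1)] \<alpha>(2) by simp
  moreover have "e 0 \<star> e \<mu> = \<mu> *s e \<mu>"
    using base \<beta> by (auto simp: root_base_def)
  ultimately have eig: "e 0 \<star> w = \<gamma> (e 0) *s w"
    using mult_mult_eq[of "e 0" "e \<kappa>" "e \<mu>"]
    by (simp add: w_def \<gamma>_def \<alpha> \<beta> mult_simps scale_left_distrib)
  have w: "w \<in> root_space \<hh> \<gamma>"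
    unfolding weight_space_def
  proof safe
    fix x assume "x \<in> \<hh>"
    then obtain c where c: "x = c *s e 0" using \<hh> by (auto simp: span_singleton)
    then have "\<gamma> x = c * \<gamma> (e 0)" using fn e0 by (auto simp: functional_on_def)
    then have "((\<lambda>z. x \<star> z - \<gamma> x *s z) ^^ 1) w = 0"
      by (simp add: c mult_simps eig)
    then show "\<exists>n. ((\<lambda>z. x \<star> z - \<gamma> x *s z) ^^ n) w = 0" by blast
  qed
  then have "\<gamma> \<in> roots \<hh>" using fn False by (auto simp: roots_def w_def)
  then have "e (\<gamma> (e 0)) \<in> root_space \<hh> \<gamma>" "e (\<gamma> (e 0)) \<noteq> 0"
    using base by (auto simp: root_base_def)
  moreover have "dim (root_space \<hh> \<gamma>) \<le> 1"
    using dims fn by (simp add: root_dims_le_1_def)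
  ultimately obtain c where "w = c *s e (\<gamma> (e 0))"
    using w by (blast elim: scaled_if_dim_le_1)
  then show thesis using that[of c] by (simp add: w_def \<gamma>_def \<alpha> \<beta>)
qed

section \<open>Edges and consecutive pairs\<close>

text \<open>The vertex conditions are absorbed in the product, as \<open>e\<close> vanishes off the vertices.\<close>

lemma edge_iff:
  assumes can: "canonical_cartan \<hh>" and dims: "root_dims_le_1 \<hh>" and base: "root_base \<hh> e"
  shows "(\<kappa>, \<mu>) \<in> graph_l_edges \<hh> e \<longleftrightarrow> e (\<mu> - \<kappa>) \<star> e \<kappa> \<noteq> 0"
proof -
  obtain c where c: "e (\<mu> - \<kappa>) \<star> e \<kappa> = c *s e \<mu>"
    using base_mult_base[OF can dims base, of "\<mu> - \<kappa>" \<kappa>] by auto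
  note zero = base_eq_0_iff[OF base]
  show ?thesis
  proof (cases "e (\<mu> - \<kappa>) \<noteq> 0 \<and> e \<kappa> \<noteq> 0 \<and> e \<mu> \<noteq> 0")
    case True
    then have "(THE c. e (\<mu> - \<kappa>) \<star> e \<kappa> = c *s e \<mu>) = c"
      by (intro the_equality) (auto simp: c)
    then show ?thesis
      using True c zero by (simp add: graph_l_edges_def graph_l_verts_def structure_const_def)
  next
    case False
    then have "e (\<mu> - \<kappa>) \<star> e \<kappa> = 0" using c by (auto simp: mult_simps)
    moreover have "(\<kappa>, \<mu>) \<notin> graph_l_edges \<hh> e"
      using False zero by (auto simp: graph_l_edges_def graph_l_verts_def structure_const_def)
    ultimately show ?thesis by simp
  qed
qed

lemma consecutive_edges:
  assumes can: "canonical_cartan \<hh>" and dims: "root_dims_le_1 \<hh>" and base: "root_base \<hh> e"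
    and edge1: "(\<kappa>, \<mu>) \<in> graph_l_edges \<hh> e" and edge2: "(\<mu>, \<nu>) \<in> graph_l_edges \<hh> e"
  shows "(\<kappa>, \<nu>) \<in> graph_l_edges \<hh> e \<or>
    ((\<kappa>, \<kappa> + \<nu> - \<mu>) \<in> graph_l_edges \<hh> e \<and> (\<kappa> + \<nu> - \<mu>, \<nu>) \<in> graph_l_edges \<hh> e)"
proof (intro disj_imp[THEN iffD2] impI)
  note edge = edge_iff[OF can dims base] and prod = base_mult_base[OF can dims base]
  define a where "a = \<mu> - \<kappa>"
  define b where "b = \<nu> - \<mu>"
  define \<mu>' where "\<mu>' = \<kappa> + \<nu> - \<mu>"
  have sums: "a + b = \<nu> - \<kappa>" "b + a = \<nu> - \<kappa>" "a + \<kappa> = \<mu>" "b + \<kappa> = \<mu>'" "\<mu>' - \<kappa> = b" "\<nu> - \<mu>' = a"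
    by (simp_all add: a_def b_def \<mu>'_def)
  assume "(\<kappa>, \<nu>) \<notin> graph_l_edges \<hh> e"
  then have no: "e (\<nu> - \<kappa>) \<star> e \<kappa> = 0" using edge by blast
  obtain c1 c2 where "e b \<star> e a = c1 *s e (\<nu> - \<kappa>)" "e a \<star> e b = c2 *s e (\<nu> - \<kappa>)"
    using prod[of b a] prod[of a b] sums by metis
  then have "lie_bracket (e b) (e a) \<star> e \<kappa> = 0"
    by (simp add: lie_bracket_def mult_simps no)
  then have swap: "e b \<star> (e a \<star> e \<kappa>) = e a \<star> (e b \<star> e \<kappa>)"
    using mult_mult_eq[of "e b" "e a" "e \<kappa>"] by simp
  obtain c where c: "e a \<star> e \<kappa> = c *s e \<mu>"
    using prod[of a \<kappa>] sums by auto
  obtain d where d: "e b \<star> e \<kappa> = d *s e \<mu>'"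
    using prod[of b \<kappa>] sums by auto
  have "c \<noteq> 0" "e b \<star> e \<mu> \<noteq> 0"
    using edge1 edge2 c by (auto simp: edge a_def b_def)
  then have "c *s (e b \<star> e \<mu>) \<noteq> 0"
    by simp
  moreover have "c *s (e b \<star> e \<mu>) = d *s (e a \<star> e \<mu>')"
    using swap by (simp add: c d mult_simps)
  ultimately have "d *s (e a \<star> e \<mu>') \<noteq> 0"
    by metis
  then have "e a \<star> e \<mu>' \<noteq> 0" "e b \<star> e \<kappa> \<noteq> 0"
    using d by (auto simp: mult_simps)
  then show "(\<kappa>, \<kappa> + \<nu> - \<mu>) \<in> graph_l_edges \<hh> e \<and> (\<kappa> + \<nu> - \<mu>, \<nu>) \<in> graph_l_edges \<hh> e"
    by (simp add: edge sums flip: \<mu>'_def)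
qed

end

theorem mainTheorem7:
  fixes scale :: "complex \<Rightarrow> 'a::ab_group_add \<Rightarrow> 'a"
    and mult :: "'a \<Rightarrow> 'a \<Rightarrow> 'a"
    and \<hh> :: "'a set"
    and e :: "complex \<Rightarrow> 'a"
    and \<kappa> \<mu> \<nu> :: complex
  assumes "left_symmetric_algebra scale mult"
    and "(UNIV :: 'a set) \<noteq> {0}"
    and "left_symmetric_algebra.complete_lsa scale mult"
    and "left_symmetric_algebra.canonical_cartan scale mult \<hh>"
    and "left_symmetric_algebra.root_dims_le_1 scale mult \<hh>"
    and "left_symmetric_algebra.root_base scale mult \<hh> e"
    and "(\<kappa>, \<mu>) \<in> left_symmetric_algebra.graph_l_edges scale mult \<hh> e"
    and "(\<mu>, \<nu>) \<in> left_symmetric_algebra.graph_l_edges scale mult \<hh> e"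
  shows "(\<kappa>, \<nu>) \<in> left_symmetric_algebra.graph_l_edges scale mult \<hh> e \<or>
    (\<kappa> + \<nu> - \<mu> \<in> left_symmetric_algebra.graph_l_verts scale mult \<hh> e \<and>
     (\<kappa>, \<kappa> + \<nu> - \<mu>) \<in> left_symmetric_algebra.graph_l_edges scale mult \<hh> e \<and>
     (\<kappa> + \<nu> - \<mu>, \<nu>) \<in> left_symmetric_algebra.graph_l_edges scale mult \<hh> e)"
proof -
  interpret left_symmetric_algebra scale mult by (rule assms(1))
  show ?thesis
    using consecutive_edges[OF assms(4-8)] by (auto simp: graph_l_edges_def)
qed

end
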